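(* Let $k\geq 2$ and $n$ be integers with $2k+1\leq n\leq k^{3}/2+k^{2}/2+k+2$. Then there exists a graph $G$ of order $n$, with minimum degree $\delta(G)\geq k$, such that $G$ is a proper subgraph of $N_{k}(n)$ and $\lambda(G)>n-k-2$.
   Context: Graphs are finite, simple and undirected. $\lambda(G)$ denotes the spectral radius (largest eigenvalue) of the adjacency matrix of $G$, and $\delta(G)$ its minimum degree. $K_s$ and $\overline{K}_s$ denote the complete graph and the edgeless graph of order $s$; $G\vee H$ denotes the join and $G+H$ the disjoint union of graphs $G$ and $H$. For $k\geq 1$ and $n\geq 2k+1$, \[ N_k(n):=K_k\vee (K_{n-2k-1}+\overline{K}_{k+1}), \] which is a graph of order $n$. *)

theory Defs
  imports "Graph_Theory.Graph_Theory" "Jordan_Normal_Form.Spectral_Radius"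
begin

text \<open>
  Finite simple undirected graphs are the \<^locale>\<open>pair_graph\<close>s of the library, i.e. finite
  digraphs without loops and parallel arcs whose arc relation is symmetric.  An edge \<open>uv\<close> is
  represented by the two arcs \<open>(u, v)\<close> and \<open>(v, u)\<close>, so that the degree of a vertex is its
  \<^const>\<open>out_degree\<close>.
\<close>

definition complete_gr :: "nat \<Rightarrow> nat pair_pre_digraph" where
  "complete_gr s = \<lparr> pverts = {..<s}, parcs = {(u, v). u < s \<and> v < s \<and> u \<noteq> v} \<rparr>"

definition edgeless_gr :: "nat \<Rightarrow> nat pair_pre_digraph" where
  "edgeless_gr s = \<lparr> pverts = {..<s}, parcs = {} \<rparr>"

definition disjoint_union_gr ::
  "'a pair_pre_digraph \<Rightarrow> 'b pair_pre_digraph \<Rightarrow> ('a + 'b) pair_pre_digraph" where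
  "disjoint_union_gr G H =
     \<lparr> pverts = pverts G <+> pverts H,
       parcs = map_prod Inl Inl ` parcs G \<union> map_prod Inr Inr ` parcs H \<rparr>"

definition join_gr ::
  "'a pair_pre_digraph \<Rightarrow> 'b pair_pre_digraph \<Rightarrow> ('a + 'b) pair_pre_digraph" where
  "join_gr G H =
     \<lparr> pverts = pverts G <+> pverts H,
       parcs = parcs (disjoint_union_gr G H)
         \<union> Inl ` pverts G \<times> Inr ` pverts H \<union> Inr ` pverts H \<times> Inl ` pverts G \<rparr>"

text \<open>The subtraction is on natural numbers; it is exact for \<open>n \<ge> 2 * k + 1\<close>.\<close>

definition N_gr :: "nat \<Rightarrow> nat \<Rightarrow> (nat + (nat + nat)) pair_pre_digraph" where
  "N_gr k n = join_gr (complete_gr k)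
     (disjoint_union_gr (complete_gr (n - 2 * k - 1)) (edgeless_gr (k + 1)))"

definition min_degree :: "'a pair_pre_digraph \<Rightarrow> nat" where
  "min_degree G = Min (out_degree (with_proj G) ` pverts G)"

definition proper_subgraph :: "'a pair_pre_digraph \<Rightarrow> 'a pair_pre_digraph \<Rightarrow> bool" where
  "proper_subgraph H G \<longleftrightarrow> subgraph (with_proj H) (with_proj G) \<and> H \<noteq> G"

text \<open>
  Matrices are indexed by \<open>0, \<dots>, n - 1\<close>, so the adjacency matrix depends on an enumeration \<open>xs\<close>
  of the vertices; the spectral radius does not (see \<open>graph_spectral_radius_eq\<close> below).  The
  entries are complex because \<^const>\<open>spectral_radius\<close> is defined for complex matrices.
\<close>

definition adjacency_matrix :: "'a list \<Rightarrow> 'a pair_pre_digraph \<Rightarrow> complex mat" where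
  "adjacency_matrix xs G = mat (length xs) (length xs)
     (\<lambda>(i, j). if (xs ! i, xs ! j) \<in> parcs G then 1 else 0)"

definition graph_spectral_radius :: "'a pair_pre_digraph \<Rightarrow> real" where
  "graph_spectral_radius G =
     spectral_radius (adjacency_matrix (SOME xs. distinct xs \<and> set xs = pverts G) G)"


lemma pair_graph_complete_gr: "pair_graph (complete_gr s)"
proof
  have "parcs (complete_gr s) \<subseteq> {..<s} \<times> {..<s}"
    by (auto simp: complete_gr_def)
  then show "finite (parcs (complete_gr s))"
    by (rule finite_subset) simp
qed (auto simp: complete_gr_def symmetric_def arcs_ends_conv intro!: symI)

lemma pair_graph_edgeless_gr: "pair_graph (edgeless_gr s)"
  by unfold_locales (auto simp: edgeless_gr_def symmetric_def intro!: symI)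

lemma pair_graph_disjoint_union_gr:
  assumes "pair_graph G" "pair_graph H"
  shows "pair_graph (disjoint_union_gr G H)"
proof -
  interpret G: pair_graph G by fact
  interpret H: pair_graph H by fact
  have "sym (parcs G)" "sym (parcs H)"
    using G.pair_sym_arcs H.pair_sym_arcs by (simp_all add: symmetric_def)
  then show ?thesis
    using G.pair_finite_verts H.pair_finite_verts G.pair_finite_arcs H.pair_finite_arcs
    by unfold_locales
      (auto simp: disjoint_union_gr_def symmetric_def sym_def
        dest: G.in_arcsD1 G.in_arcsD2 H.in_arcsD1 H.in_arcsD2 G.pair_no_loops H.pair_no_loops)
qed

lemma pair_graph_join_gr:
  assumes "pair_graph G" "pair_graph H"
  shows "pair_graph (join_gr G H)"
proof -
  interpret G: pair_graph G by fact
  interpret H: pair_graph H by fact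
  interpret U: pair_graph "disjoint_union_gr G H"
    using assms by (rule pair_graph_disjoint_union_gr)
  have verts: "pverts (join_gr G H) = pverts (disjoint_union_gr G H)"
    by (simp add: join_gr_def disjoint_union_gr_def)
  have arcs: "parcs (join_gr G H) = parcs (disjoint_union_gr G H)
      \<union> Inl ` pverts G \<times> Inr ` pverts H \<union> Inr ` pverts H \<times> Inl ` pverts G"
    by (simp add: join_gr_def)
  have new: "Inl ` pverts G \<subseteq> pverts (disjoint_union_gr G H)"
      "Inr ` pverts H \<subseteq> pverts (disjoint_union_gr G H)"
    by (auto simp: disjoint_union_gr_def)
  have "sym (parcs (disjoint_union_gr G H))"
    using U.pair_sym_arcs by (simp add: symmetric_def)
  then have "sym (parcs (join_gr G H))"
    unfolding arcs sym_def by blast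
  then have "symmetric (with_proj (join_gr G H))"
    by (simp add: symmetric_def)
  moreover have "fst e \<in> pverts (join_gr G H)" "snd e \<in> pverts (join_gr G H)" "fst e \<noteq> snd e"
    if "e \<in> parcs (join_gr G H)" for e
    using that new U.arc_fst_in_verts[of e] U.arc_snd_in_verts[of e] U.pair_no_loops[of e]
    unfolding arcs verts by auto
  moreover have "finite (pverts (join_gr G H))" "finite (parcs (join_gr G H))"
    using U.pair_finite_verts U.pair_finite_arcs G.pair_finite_verts H.pair_finite_verts
    by (simp_all add: verts arcs)
  ultimately show ?thesis
    by unfold_locales
qed

lemma pair_graph_N_gr: "pair_graph (N_gr k n)"
  unfolding N_gr_def
  by (intro pair_graph_join_gr pair_graph_disjoint_union_gr
      pair_graph_complete_gr pair_graph_edgeless_gr)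

lemma order_N_gr: "n \<ge> 2 * k + 1 \<Longrightarrow> card (pverts (N_gr k n)) = n"
  by (simp add: N_gr_def join_gr_def disjoint_union_gr_def complete_gr_def edgeless_gr_def
      card_Plus)

lemma spectrum_adjacency_matrix_subset:
  assumes xs: "distinct xs" "set xs = V" and ys: "distinct ys" "set ys = V"
  shows "spectrum (adjacency_matrix xs G) \<subseteq> spectrum (adjacency_matrix ys G)"
proof
  have len: "length ys = length xs"
    using xs ys by (metis distinct_card)
  define n where "n = length xs"
  have lens: "length xs = n" "length ys = n"
    using len n_def by auto
  have b_xs: "bij_betw ((!) xs) {0..<n} V" and b_ys: "bij_betw ((!) ys) {0..<n} V"
    using xs ys lens by (auto intro!: bij_betw_nth)
  define f where "f = (\<lambda>i. inv_into {0..<n} ((!) xs) (ys ! i))"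
  have bf: "bij_betw f {0..<n} {0..<n}"
    using bij_betw_trans[OF b_ys bij_betw_inv_into[OF b_xs]] by (simp add: f_def o_def)
  have xf: "xs ! f i = ys ! i" if "i < n" for i
    using b_xs b_ys that unfolding f_def
    by (metis atLeastLessThan_iff bij_betwE bij_betw_inv_into_right zero_le)
  have fn: "f i < n" if "i < n" for i
    using bij_betwE[OF bf] that by auto
  have carr: "dim_row (adjacency_matrix zs G) = n" "dim_col (adjacency_matrix zs G) = n"
    if "length zs = n" for zs
    using that by (simp_all add: adjacency_matrix_def)
  fix e assume "e \<in> spectrum (adjacency_matrix xs G)"
  then obtain v where v: "v \<in> carrier_vec n" "v \<noteq> 0\<^sub>v n"
      "adjacency_matrix xs G *\<^sub>v v = e \<cdot>\<^sub>v v"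
    by (auto simp: spectrum_def eigenvalue_def eigenvector_def carr lens)
  define w where "w = vec n (\<lambda>i. v $ f i)"
  have "w \<noteq> 0\<^sub>v n"
  proof
    assume 0: "w = 0\<^sub>v n"
    have "v $ i = 0" if "i < n" for i
    proof -
      have "i \<in> f ` {0..<n}"
        using that bf by (simp add: bij_betw_def)
      then obtain j where "j < n" "f j = i"
        by auto
      then show ?thesis
        using arg_cong[OF 0, of "\<lambda>u. u $ j"] by (simp add: w_def)
    qed
    then show False
      using v by auto
  qed
  moreover have "adjacency_matrix ys G *\<^sub>v w = e \<cdot>\<^sub>v w"
  proof (rule eq_vecI)
    fix i assume "i < dim_vec (e \<cdot>\<^sub>v w)"
    then have i: "i < n" by (simp add: w_def)
    let ?g = "\<lambda>j. (if (ys ! i, xs ! j) \<in> parcs G then 1 else 0) * v $ j"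
    have "(adjacency_matrix ys G *\<^sub>v w) $ i =
        (\<Sum>j\<in>{0..<n}. (if (ys ! i, ys ! j) \<in> parcs G then 1 else 0) * v $ f j)"
      using i lens by (simp add: adjacency_matrix_def scalar_prod_def w_def)
    also have "\<dots> = (\<Sum>j\<in>{0..<n}. ?g (f j))"
      by (intro sum.cong) (auto simp: xf)
    also have "\<dots> = (\<Sum>j\<in>{0..<n}. ?g j)"
      by (rule sum.reindex_bij_betw[OF bf])
    also have "\<dots> = (adjacency_matrix xs G *\<^sub>v v) $ f i"
      using i lens v(1) fn xf by (simp add: adjacency_matrix_def scalar_prod_def)
    also have "\<dots> = (e \<cdot>\<^sub>v w) $ i"
      using v i fn by (simp add: w_def)
    finally show "(adjacency_matrix ys G *\<^sub>v w) $ i = (e \<cdot>\<^sub>v w) $ i" .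
  qed (simp add: w_def carr lens)
  ultimately show "e \<in> spectrum (adjacency_matrix ys G)"
    by (auto simp: spectrum_def eigenvalue_def eigenvector_def carr lens w_def
        intro!: exI[of _ w])
qed

lemma graph_spectral_radius_eq:
  assumes "distinct xs" "set xs = pverts G"
  shows "graph_spectral_radius G = spectral_radius (adjacency_matrix xs G)"
proof -
  let ?ys = "SOME xs. distinct xs \<and> set xs = pverts G"
  have "distinct ?ys \<and> set ?ys = pverts G"
    by (rule someI_ex) (use assms in blast)
  then have "spectrum (adjacency_matrix ?ys G) = spectrum (adjacency_matrix xs G)"
    using assms by (intro equalityI spectrum_adjacency_matrix_subset) auto
  then show ?thesis
    by (simp add: graph_spectral_radius_def spectral_radius_def)
qed

end

theory Submission
  imports Defs
begin

text \<open>
  Delete one edge from \<open>N\<^sub>k(n)\<close> so that all edges between the core \<open>K\<^sub>k\<close> and the rest survive;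
  then every degree is still at least \<open>k\<close>.  If \<open>n \<ge> 2k + 3\<close> the edge is taken inside \<open>K\<^sub>m\<close>,
  where \<open>m = n - 2k - 1\<close>, otherwise inside the core.  (An edge of the core would not do in general:
  for \<open>k = 2\<close> and \<open>n = 10\<close> deleting it gives spectral radius exactly \<open>n - k - 2\<close>.)

  By Collatz--Wielandt, a positive weighting of the vertices for which every neighbourhood has
  weight more than \<open>t\<close> times the weight of its centre forces a spectral radius above \<open>t\<close>.
  The quadratic form of the adjacency matrix at the weighting \<open>1\<close> on the clique and \<open>k/t\<close> on
  the independent set, with \<open>t = n - k - 2\<close>, exceeds \<open>t\<close> times the squared norm by
  \<open>k\<^sup>2(k + 1)/t - 2\<close>, which is where the bound on \<open>n\<close> comes from; a small perturbation of this
  weighting satisfies the strict inequality at every vertex.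
\<close>

section \<open>Collatz-Wielandt lower bounds for the spectral radius\<close>

lemma spectral_radius_gt_if_strictly_subinvariant:
  fixes A :: "complex mat" and a :: "nat \<Rightarrow> nat \<Rightarrow> real"
  assumes A: "A \<in> carrier_mat n n" and n: "n > 0"
    and A_a: "\<And>i j. i < n \<Longrightarrow> j < n \<Longrightarrow> A $$ (i, j) = of_real (a i j)"
    and a_nonneg: "\<And>i j. a i j \<ge> 0"
    and f_pos: "\<And>i. i < n \<Longrightarrow> f i > 0"
    and t: "t \<ge> 0"
    and sub: "\<And>i. i < n \<Longrightarrow> t * f i < (\<Sum>j<n. a i j * f j)"
  shows "t < spectral_radius A"
proof (rule ccontr)
  \<comment> \<open>Otherwise, for some \<open>s\<close> between \<open>t\<close> and the minimal growth factor \<open>r\<close> of \<open>f\<close>, the powers of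
      \<open>A / s\<close> stay bounded although they stretch \<open>f\<close> by the factors \<open>(r / s)\<^sup>k\<close>.\<close>
  assume "\<not> t < spectral_radius A"
  define F where "F g i = (\<Sum>j<n. a i j * g j)" for g :: "nat \<Rightarrow> real" and i
  define r where "r = Min ((\<lambda>i. F f i / f i) ` {..<n})"
  have "r \<in> (\<lambda>i. F f i / f i) ` {..<n}"
    unfolding r_def using n by (intro Min_in) auto
  with sub f_pos have "t < r"
    by (auto simp: F_def less_divide_eq)
  have F_ge: "r * f i \<le> F f i" if "i < n" for i
  proof -
    have "r \<le> F f i / f i"
      unfolding r_def using that by (intro Min_le) auto
    with f_pos[OF that] show ?thesis
      by (simp add: le_divide_eq)
  qed
  obtain s where s: "t < s" "s < r"
    using dense \<open>t < r\<close> by blast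
  then have "s > 0" using t by simp
  define B where "B = (1 / of_real s) \<cdot>\<^sub>m A"
  have B: "B \<in> carrier_mat n n"
    using A by (simp add: B_def)
  \<comment> \<open>If \<open>e\<close> is an eigenvalue of \<open>B\<close>, then
    \<open>s * e\<close> is one of \<open>A\<close>, so its modulus is at most
    \<open>t < s\<close>.\<close>
  have "spectral_radius B < 1"
  proof -
    obtain e where e: "e \<in> spectrum B" "spectral_radius B = norm e"
      using spectral_radius_mem_max(1)[OF B n] by auto
    then obtain v where v: "v \<in> carrier_vec n" "v \<noteq> 0\<^sub>v n" "B *\<^sub>v v = e \<cdot>\<^sub>v v"
      using B by (auto simp: spectrum_def eigenvalue_def eigenvector_def)
    have "A *\<^sub>v v = of_real s \<cdot>\<^sub>v (B *\<^sub>v v)"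
      using A v(1) \<open>s > 0\<close> by (auto simp: B_def scalar_prod_def sum_distrib_left)
    then have "A *\<^sub>v v = (of_real s * e) \<cdot>\<^sub>v v"
      using v(3) by (simp add: smult_smult_assoc)
    with v A have "of_real s * e \<in> spectrum A"
      by (auto simp: spectrum_def eigenvalue_def eigenvector_def)
    then have "norm (of_real s * e) \<le> spectral_radius A"
      by (intro spectral_radius_mem_max(2)[OF A n] imageI)
    then have "s * norm e < s * 1"
      using \<open>s > 0\<close> s \<open>\<not> t < spectral_radius A\<close> unfolding norm_mult norm_of_real by linarith
    with e \<open>s > 0\<close> show ?thesis
      by (simp only: mult_less_cancel_left_pos)
  qed
  then obtain c where c: "norm_bound (B ^\<^sub>m k) c" for k
    using spectral_radius_jnf_norm_bound_less_1_upper_triangular[OF B] by blast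
  define G where "G g i = F g i / s" for g :: "nat \<Rightarrow> real" and i
  have B_vec: "B *\<^sub>v vec n (\<lambda>i. of_real (g i)) = vec n (\<lambda>i. of_real (G g i))" for g
    using A by (auto simp: B_def G_def F_def scalar_prod_def A_a lessThan_atLeast0
        sum_divide_distrib)
  have pow: "B ^\<^sub>m k *\<^sub>v vec n (\<lambda>i. of_real (g i)) = vec n (\<lambda>i. of_real ((G ^^ k) g i))" for k g
  \<comment> \<open>The new factor of \<open>B ^\<^sub>m Suc k\<close> stands on the right and acts
    first, so the induction hypothesis is needed at \<open>G g\<close>.\<close>
  proof (induction k arbitrary: g)
    case 0
    then show ?case using B by simp
  next
    case (Suc k)
    have "B ^\<^sub>m Suc k *\<^sub>v vec n (\<lambda>i. of_real (g i)) = B ^\<^sub>m k *\<^sub>v (B *\<^sub>v vec n (\<lambda>i. of_real (g i)))"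
      using B by (simp add: assoc_mult_mat_vec[of _ n n _ n])
    then show ?case
      by (simp only: B_vec Suc.IH funpow_Suc_right o_apply)
  qed
  define q where "q = r / s"
  have "q > 1"
    using s \<open>s > 0\<close> by (simp add: q_def)
  \<comment> \<open>Since \<open>a\<close> is nonnegative, \<open>G\<close> is monotone, and the
    growth of \<open>f\<close> by the factor \<open>q\<close> in one step iterates.\<close>
  have G_pow_ge: "q ^ k * f i \<le> (G ^^ k) f i" if "i < n" for k i
    using that
  proof (induction k arbitrary: i)
    case 0
    then show ?case by simp
  next
    case (Suc k)
    have "q ^ Suc k * f i = q ^ k * (r * f i) / s"
      by (simp add: q_def)
    also have "\<dots> \<le> q ^ k * F f i / s"
      using F_ge[OF Suc.prems] \<open>q > 1\<close> \<open>s > 0\<close> by (intro divide_right_mono mult_left_mono) auto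
    also have "\<dots> = (\<Sum>j<n. a i j * (q ^ k * f j)) / s"
      by (simp add: F_def sum_distrib_left mult_ac)
    also have "\<dots> \<le> G ((G ^^ k) f) i"
      unfolding G_def[of "(G ^^ k) f"] F_def using Suc.IH a_nonneg \<open>s > 0\<close>
      by (intro divide_right_mono sum_mono mult_left_mono) auto
    finally show ?case by simp
  qed
  define C where "C = (\<Sum>j<n. c * f j)"
  \<comment> \<open>Coordinate 0, available because \<open>n > 0\<close>, already separates the
    uniform bound on the powers of \<open>B\<close> from the geometric growth.\<close>
  have "q ^ k \<le> C / f 0" for k
  proof -
    have "norm ((B ^\<^sub>m k *\<^sub>v vec n (\<lambda>i. of_real (f i))) $ 0) \<le> C"
    proof -
      have "norm ((B ^\<^sub>m k *\<^sub>v vec n (\<lambda>i. of_real (f i))) $ 0)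
          = norm (\<Sum>j<n. (B ^\<^sub>m k) $$ (0, j) * of_real (f j))"
        using B n by (simp add: scalar_prod_def lessThan_atLeast0)
      also have "\<dots> \<le> (\<Sum>j<n. norm ((B ^\<^sub>m k) $$ (0, j)) * f j)"
        using f_pos by (intro order_trans[OF norm_sum] sum_mono) (auto simp: norm_mult less_imp_le)
      also have "\<dots> \<le> C"
        unfolding C_def using c[of k] B n f_pos
        by (intro sum_mono mult_right_mono) (auto simp: norm_bound_def less_imp_le)
      finally show ?thesis .
    qed
    moreover have "norm ((B ^\<^sub>m k *\<^sub>v vec n (\<lambda>i. of_real (f i))) $ 0) \<ge> q ^ k * f 0"
      using G_pow_ge[OF n, of k] n by (simp add: pow)
    ultimately show ?thesis
      using f_pos[OF n] by (simp add: le_divide_eq)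
  qed
  with real_arch_pow[OF \<open>q > 1\<close>, of "C / f 0"] show False
    by (auto simp: not_less[symmetric])
qed

lemma graph_spectral_radius_gt:
  fixes G :: "'a pair_pre_digraph" and f :: "'a \<Rightarrow> real"
  assumes "finite (pverts G)" "pverts G \<noteq> {}" and t: "t \<ge> 0"
    and pos: "\<And>v. v \<in> pverts G \<Longrightarrow> f v > 0"
    and sub: "\<And>v. v \<in> pverts G \<Longrightarrow>
      t * f v < (\<Sum>w\<in>pverts G. if (v, w) \<in> parcs G then f w else 0)"
  shows "graph_spectral_radius G > t"
proof -
  obtain xs where xs: "distinct xs" "set xs = pverts G"
    using finite_distinct_list[OF assms(1)] by auto
  define a :: "nat \<Rightarrow> nat \<Rightarrow> real"
    where "a i j = of_bool ((xs ! i, xs ! j) \<in> parcs G)" for i j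
  have "t < spectral_radius (adjacency_matrix xs G)"
  proof (rule spectral_radius_gt_if_strictly_subinvariant[where n = "length xs" and a = a
        and f = "\<lambda>i. f (xs ! i)"])
    fix i assume i: "i < length xs"
    have "(\<Sum>w\<in>pverts G. if (xs ! i, w) \<in> parcs G then f w else 0)
        = (\<Sum>j<length xs. if (xs ! i, xs ! j) \<in> parcs G then f (xs ! j) else 0)"
      using xs by (intro sum.reindex_bij_betw[symmetric] bij_betw_nth) auto
    also have "\<dots> = (\<Sum>j<length xs. a i j * f (xs ! j))"
      by (intro sum.cong) (auto simp: a_def)
    finally show "t * f (xs ! i) < (\<Sum>j<length xs. a i j * f (xs ! j))"
      using sub[of "xs ! i"] i xs(2) nth_mem[OF i] by simp
  next
    show "f (xs ! i) > 0" if "i < length xs" for i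
      using that pos[of "xs ! i"] xs(2) nth_mem by blast
  qed (use xs assms(2) t in \<open>auto simp: adjacency_matrix_def a_def\<close>)
  then show ?thesis
    using graph_spectral_radius_eq[OF xs] by simp
qed

section \<open>Complete graphs with one edge deleted\<close>

definition complete_minus_edge_gr :: "nat \<Rightarrow> nat pair_pre_digraph" where
  "complete_minus_edge_gr s =
     \<lparr> pverts = {..<s}, parcs = {(u, v). u < s \<and> v < s \<and> u \<noteq> v \<and> {u, v} \<noteq> {0, 1}} \<rparr>"

lemma pair_graph_complete_minus_edge_gr: "pair_graph (complete_minus_edge_gr s)"
proof
  have "parcs (complete_minus_edge_gr s) \<subseteq> {..<s} \<times> {..<s}"
    by (auto simp: complete_minus_edge_gr_def)
  then show "finite (parcs (complete_minus_edge_gr s))"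
    by (rule finite_subset) simp
qed (auto simp: complete_minus_edge_gr_def symmetric_def arcs_ends_conv doubleton_eq_iff intro!: symI)

lemma complete_minus_edge_gr_subset: "parcs (complete_minus_edge_gr s) \<subseteq> parcs (complete_gr s)"
  by (auto simp: complete_minus_edge_gr_def complete_gr_def)

lemma complete_minus_edge_gr_neq:
  assumes "s \<ge> 2"
  shows "parcs (complete_minus_edge_gr s) \<noteq> parcs (complete_gr s)"
proof -
  have "(0, 1) \<in> parcs (complete_gr s)" "(0, 1) \<notin> parcs (complete_minus_edge_gr s)"
    using assms by (auto simp: complete_minus_edge_gr_def complete_gr_def)
  then show ?thesis by blast
qed

lemma sum_neighbours_complete_gr:
  fixes g :: "nat \<Rightarrow> real"
  assumes "i < s"
  shows "(\<Sum>j<s. if (i, j) \<in> parcs (complete_gr s) then g j else 0) = (\<Sum>j<s. g j) - g i"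
proof -
  have "(\<Sum>j<s. if (i, j) \<in> parcs (complete_gr s) then g j else 0) = (\<Sum>j\<in>{..<s} - {i}. g j)"
    using assms by (intro sum.mono_neutral_cong_right) (auto simp: complete_gr_def)
  then show ?thesis
    using assms by (simp add: sum_diff1)
qed

text \<open>Both endpoints of the deleted edge miss exactly \<open>{0, 1}\<close>, themselves
  included, so they share one formula. For \<open>s < 2\<close> there would be no edge to
  delete.\<close>

lemma sum_neighbours_complete_minus_edge_gr:
  fixes g :: "nat \<Rightarrow> real"
  assumes "i < s" "s \<ge> 2"
  shows "(\<Sum>j<s. if (i, j) \<in> parcs (complete_minus_edge_gr s) then g j else 0)
    = (\<Sum>j<s. g j) - (if i < 2 then g 0 + g 1 else g i)"
proof -
  let ?X = "if i < 2 then {0, 1} else {i}"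
  have "(\<Sum>j<s. if (i, j) \<in> parcs (complete_minus_edge_gr s) then g j else 0)
      = (\<Sum>j\<in>{..<s} - ?X. g j)"
    using assms
    by (intro sum.mono_neutral_cong_right)
      (auto simp: complete_minus_edge_gr_def doubleton_eq_iff less_2_cases_iff split: if_splits)
  also have "\<dots> = (\<Sum>j<s. g j) - (\<Sum>j\<in>?X. g j)"
    using assms by (intro sum_diff) (auto simp: less_2_cases_iff)
  finally show ?thesis by simp
qed

section \<open>Graphs shaped like \<open>N_gr k n\<close>, with variable core and clique\<close>

definition core_gr ::
  "nat \<Rightarrow> 'a pair_pre_digraph \<Rightarrow> 'b pair_pre_digraph \<Rightarrow> ('a + ('b + nat)) pair_pre_digraph" where
  "core_gr k H K = join_gr H (disjoint_union_gr K (edgeless_gr (k + 1)))"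

lemma pverts_core_gr: "pverts (core_gr k H K) = pverts H <+> (pverts K <+> {..<k + 1})"
  by (simp add: core_gr_def join_gr_def disjoint_union_gr_def edgeless_gr_def)

lemma in_parcs_core_gr_iff:
  "(Inl i, Inl j) \<in> parcs (core_gr k H K) \<longleftrightarrow> (i, j) \<in> parcs H"
  "(Inr (Inl x), Inr (Inl y)) \<in> parcs (core_gr k H K) \<longleftrightarrow> (x, y) \<in> parcs K"
  "(Inl i, Inr w) \<in> parcs (core_gr k H K) \<longleftrightarrow> i \<in> pverts H \<and> w \<in> pverts K <+> {..<k + 1}"
  "(Inr w, Inl i) \<in> parcs (core_gr k H K) \<longleftrightarrow> i \<in> pverts H \<and> w \<in> pverts K <+> {..<k + 1}"
  "(Inr (Inr u), Inr w) \<notin> parcs (core_gr k H K)"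
  "(Inr w, Inr (Inr u)) \<notin> parcs (core_gr k H K)"
  by (auto simp: core_gr_def join_gr_def disjoint_union_gr_def edgeless_gr_def)

lemma pair_graph_core_gr:
  "pair_graph H \<Longrightarrow> pair_graph K \<Longrightarrow> pair_graph (core_gr k H K)"
  unfolding core_gr_def
  by (intro pair_graph_join_gr pair_graph_disjoint_union_gr pair_graph_edgeless_gr)

lemma N_gr_eq_core_gr: "N_gr k n = core_gr k (complete_gr k) (complete_gr (n - 2 * k - 1))"
  by (simp add: N_gr_def core_gr_def)

text \<open>The arcs of \<open>H\<close> and \<open>K\<close> can be read off the whole graph, so an
  arc missing from either part makes the inclusion proper.\<close>

lemma proper_subgraph_core_gr:
  assumes "pair_graph H" "pair_graph K" "pair_graph H'" "pair_graph K'"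
    and "pverts H = pverts H'" "pverts K = pverts K'"
    and "parcs H \<subseteq> parcs H'" "parcs K \<subseteq> parcs K'"
    and neq: "parcs H \<noteq> parcs H' \<or> parcs K \<noteq> parcs K'"
  shows "proper_subgraph (core_gr k H K) (core_gr k H' K')"
proof -
  interpret G: pair_graph "core_gr k H K"
    using assms by (intro pair_graph_core_gr)
  interpret G': pair_graph "core_gr k H' K'"
    using assms by (intro pair_graph_core_gr)
  have "parcs H = parcs H' \<and> parcs K = parcs K'" if "core_gr k H K = core_gr k H' K'"
    using that in_parcs_core_gr_iff(1,2)[of _ _ k H K] in_parcs_core_gr_iff(1,2)[of _ _ k H' K']
    by auto
  moreover have "subgraph (with_proj (core_gr k H K)) (with_proj (core_gr k H' K'))"
  proof (intro subgraphI compatibleI_with_proj)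
    have "(v, w) \<in> parcs (core_gr k H' K')" if "(v, w) \<in> parcs (core_gr k H K)" for v w
      using that assms(5-8)
      \<comment> \<open>The value of \<open>projr\<close> matters only outside the core; for a core
        vertex the extra split is harmless.\<close>
      by (cases v; cases w; cases "projr v"; cases "projr w") (auto simp: in_parcs_core_gr_iff)
    then show "arcs (with_proj (core_gr k H K)) \<subseteq> arcs (with_proj (core_gr k H' K'))"
      by auto
  qed (use assms G.wf_digraph G'.wf_digraph in \<open>auto simp: pverts_core_gr\<close>)
  ultimately show ?thesis
    using neq by (auto simp: proper_subgraph_def)
qed

text \<open>A core vertex sees all \<open>k + 1\<close> independent vertices, and every other vertex
  sees the whole core; edges inside \<open>H\<close> or \<open>K\<close> are not counted.\<close>

lemma min_degree_core_gr:
  assumes "pair_graph H" "pair_graph K" "card (pverts H) = k"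
  shows "min_degree (core_gr k H K) \<ge> k"
proof -
  let ?G = "core_gr k H K"
  interpret G: pair_graph ?G
    using assms by (intro pair_graph_core_gr)
  have out_degree: "out_degree (with_proj ?G) v \<ge> card W" if "\<And>w. w \<in> W \<Longrightarrow> (v, w) \<in> parcs ?G" for v W
  proof -
    have "card W = card (Pair v ` W)"
      by (simp add: card_image inj_on_def)
    also have "\<dots> \<le> card (out_arcs (with_proj ?G) v)"
      using that G.pair_finite_arcs by (intro card_mono) (auto simp: out_arcs_def)
    finally show ?thesis
      by (simp add: out_degree_def)
  qed
  have "k \<le> out_degree (with_proj ?G) v" if "v \<in> pverts ?G" for v
  proof (cases v)
    case (Inl i)
    then have "card ((Inr \<circ> Inr) ` {..<k + 1} :: ('a + ('b + nat)) set) \<le> out_degree (with_proj ?G) v"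
      using that by (intro out_degree) (auto simp: pverts_core_gr in_parcs_core_gr_iff)
    then show ?thesis
      by (simp add: card_image inj_on_def)
  next
    case (Inr w)
    then have "card (Inl ` pverts H :: ('a + ('b + nat)) set) \<le> out_degree (with_proj ?G) v"
      using that by (intro out_degree) (auto simp: pverts_core_gr in_parcs_core_gr_iff)
    then show ?thesis
      by (simp add: card_image assms)
  qed
  moreover have "Inr (Inr 0) \<in> pverts ?G"
    by (auto simp: pverts_core_gr)
  ultimately show ?thesis
    unfolding min_degree_def using G.pair_finite_verts by (intro Min.boundedI) auto
qed

text \<open>All independent vertices have the core as neighbourhood, so they can share one weight
  \<open>d\<close>, and the Collatz-Wielandt condition splits by vertex class.\<close>

lemma graph_spectral_radius_core_gr_gt:
  fixes k m :: nat and \<alpha> \<beta> :: "nat \<Rightarrow> real"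
  assumes H: "pverts H = {..<k}" and K: "pverts K = {..<m}"
    and "t \<ge> 0" "d > 0" "\<And>i. \<alpha> i > 0" "\<And>i. \<beta> i > 0"
    and sub_H: "\<And>i. i < k \<Longrightarrow> t * \<alpha> i
      < (\<Sum>j<k. if (i, j) \<in> parcs H then \<alpha> j else 0) + (\<Sum>j<m. \<beta> j) + (real k + 1) * d"
    and sub_K: "\<And>i. i < m \<Longrightarrow> t * \<beta> i
      < (\<Sum>j<k. \<alpha> j) + (\<Sum>j<m. if (i, j) \<in> parcs K then \<beta> j else 0)"
    and sub_I: "t * d < (\<Sum>j<k. \<alpha> j)"
  shows "graph_spectral_radius (core_gr k H K) > t"
proof (rule graph_spectral_radius_gt[where f = "case_sum \<alpha> (case_sum \<beta> (\<lambda>_. d))"])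
  fix v assume "v \<in> pverts (core_gr k H K)"
  then consider (core) i where "i < k" "v = Inl i" | (clique) i where "i < m" "v = Inr (Inl i)"
    | (isolated) i where "i < k + 1" "v = Inr (Inr i)"
    by (auto simp: pverts_core_gr H K)
  then show "t * case_sum \<alpha> (case_sum \<beta> (\<lambda>_. d)) v < (\<Sum>w\<in>pverts (core_gr k H K).
      if (v, w) \<in> parcs (core_gr k H K) then case_sum \<alpha> (case_sum \<beta> (\<lambda>_. d)) w else 0)"
    by cases (use sub_H sub_K sub_I in
      \<open>simp_all add: pverts_core_gr H K sum.Plus in_parcs_core_gr_iff InlI InrI algebra_simps cong: sum.cong_simp if_cong\<close>)
qed (use assms in \<open>auto simp: pverts_core_gr\<close>)


section \<open>Spectral radius for the two choices of the deleted edge\<close>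

lemma core_minus_edge_spectral_radius_gt:
  assumes "k \<ge> 2" "m \<le> 1"
  shows "graph_spectral_radius (core_gr k (complete_minus_edge_gr k) (complete_gr m))
    > real k + real m - 1"
\<comment> \<open>As \<open>m \<le> 1\<close>, the target is at most \<open>k\<close>, so any weight
  below 1 works outside the core; \<open>9 / 10\<close> is still large enough for the independent
  set to make up for the edge lost in the core.\<close>
proof (rule graph_spectral_radius_core_gr_gt
    [where m = m and \<alpha> = "\<lambda>_. 1" and \<beta> = "\<lambda>_. 9 / 10" and d = "9 / 10"])
  have "m = 0 \<or> m = 1" "real k \<ge> 2" using assms by auto
  then show "(real k + real m - 1) * 1
      < (\<Sum>j<k. if (i, j) \<in> parcs (complete_minus_edge_gr k) then 1 else 0) + (\<Sum>j<m. 9 / 10)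
        + (real k + 1) * (9 / 10)" if "i < k" for i
    using sum_neighbours_complete_minus_edge_gr[of i k "\<lambda>_. 1"] that \<open>k \<ge> 2\<close>
    by (auto simp: field_simps split: if_splits)
  show "(real k + real m - 1) * (9 / 10)
      < (\<Sum>j<k. 1) + (\<Sum>j<m. if (i, j) \<in> parcs (complete_gr m) then 9 / 10 else 0)" if "i < m" for i
    using sum_neighbours_complete_gr[of i m "\<lambda>_. 9 / 10"] that assms \<open>m = 0 \<or> m = 1\<close> by auto
  show "(real k + real m - 1) * (9 / 10) < (\<Sum>j<k. 1)"
    using assms \<open>m = 0 \<or> m = 1\<close> by auto
qed (use assms in \<open>auto simp: complete_minus_edge_gr_def complete_gr_def\<close>)

text \<open>Eliminating \<open>d\<close> leaves \<open>(2 / T + m * \<delta>) * (T - 1) < k * (k +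
  1) * (1 + \<delta>)\<close>. For \<open>\<delta>\<close> near \<open>2 / (k * T)\<close> the first
  factor is near \<open>2 / k\<close>, which matches \<open>bound\<close>; the factor
  \<open>1 + \<delta>\<close> provides strictness even when \<open>bound\<close> is an
  equality.\<close>

lemma clique_minus_edge_spectral_radius_gt:
  assumes k: "k \<ge> 2" and m: "m \<ge> 2"
    and bound: "2 * (real k + real m - 1) \<le> real k ^ 2 * (real k + 1)"
  shows "graph_spectral_radius (core_gr k (complete_gr k) (complete_minus_edge_gr m))
    > real k + real m - 1"
proof -
  define T where "T = real k + real m"
  \<comment> \<open>The first term gives \<open>k * \<delta> = 2 / T\<close>, the borderline at the
    clique vertices; the second makes this strict and is small enough to be absorbed by
    \<open>1 + \<delta>\<close>.\<close>
  define \<delta> where "\<delta> = 2 / (real k * T) + 2 / (real k ^ 2 * real m * T)"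
  \<comment> \<open>Lowering both endpoints by \<open>1 / T\<close> shrinks their deficit from 1 to
    \<open>1 / T\<close> and costs each other clique vertex \<open>2 / T\<close>.\<close>
  define \<beta> where "\<beta> i = (if i < 2 then 1 - 1 / T else 1)" for i :: nat
  have pos: "real k > 0" "real m > 0" "T > 0"
    using k m by (auto simp: T_def)
  then have "\<delta> > 0"
    by (simp add: \<delta>_def add_pos_pos)
  have "real k * \<delta> = 2 / T + 2 / (real k * real m * T)"
    using pos by (simp add: \<delta>_def field_simps power2_eq_square)
  then have k\<delta>: "real k * \<delta> > 2 / T"
    using pos by simp
  have "real m * \<delta> = 2 * real m / (real k * T) + 2 / real k * (1 / (real k * T))"
    using pos by (simp add: \<delta>_def field_simps power2_eq_square)
  moreover have "2 * T / (real k * T) = 2 * real k / (real k * T) + 2 * real m / (real k * T)"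
    by (simp only: T_def distrib_left add_divide_distrib)
  moreover have "2 * T / (real k * T) = 2 / real k" "2 * real k / (real k * T) = 2 / T"
    using pos by simp_all
  ultimately have "2 / T + real m * \<delta> = 2 / real k + 2 / real k * (1 / (real k * T))"
    by linarith
  also have "\<dots> < 2 / real k + 2 / real k * \<delta>"
  proof -
    have "1 / (real k * T) < \<delta>"
      using pos by (simp add: \<delta>_def add_pos_pos field_simps)
    then show ?thesis
      using pos by (intro add_strict_left_mono mult_strict_left_mono) auto
  qed
  also have "\<dots> = 2 / real k * (1 + \<delta>)"
    by (simp add: distrib_left)
  finally have "(2 / T + real m * \<delta>) * (T - 1) < 2 / real k * (1 + \<delta>) * (T - 1)"
    using pos k m by (intro mult_strict_right_mono) (auto simp: T_def)
  also have "\<dots> = (1 + \<delta>) / real k * (2 * (T - 1))"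
    by (simp add: algebra_simps add_divide_distrib diff_divide_distrib)
  \<comment> \<open>The bound on \<open>k + m\<close> enters here, as \<open>T - 1\<close> is half
    the quantity it limits.\<close>
  also have "\<dots> \<le> (1 + \<delta>) / real k * (real k ^ 2 * (real k + 1))"
    using bound pos \<open>\<delta> > 0\<close> by (intro mult_left_mono) (auto simp: T_def)
  also have "\<dots> = real k * (1 + \<delta>) * (real k + 1)"
    using pos by (simp add: power2_eq_square)
  finally have "(2 / T + real m * \<delta>) / (real k + 1) < real k * (1 + \<delta>) / (T - 1)"
    using k m by (simp add: T_def divide_less_eq less_divide_eq)
  then obtain d where d: "(2 / T + real m * \<delta>) / (real k + 1) < d"
      "d < real k * (1 + \<delta>) / (T - 1)"
    using dense by blast
  have "0 < (2 / T + real m * \<delta>) / (real k + 1)"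
    using pos \<open>\<delta> > 0\<close> by (simp add: add_pos_pos)
  with d(1) have "d > 0" by linarith
  have d1: "2 / T + real m * \<delta> < (real k + 1) * d"
    using d(1) by (simp add: divide_less_eq mult.commute)
  have d2: "(T - 1) * d < real k * (1 + \<delta>)"
    using d(2) k m by (simp add: T_def less_divide_eq mult.commute)
  \<comment> \<open>\<open>T - 1\<close> is \<open>n - k - 2\<close>, the spectral radius of the clique on the core and the \<open>m\<close> vertices.
      The weights perturb its all-ones eigenvector: \<open>d1\<close>, \<open>k\<delta>\<close> and \<open>d2\<close> are the strict
      inequalities at the core, at the \<open>m\<close> clique vertices and at the independent vertices.\<close>
  have "(\<Sum>j<m. \<beta> j) = (\<Sum>j<m. 1) - (\<Sum>j<m. if j < 2 then 1 / T else 0)"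
    unfolding sum_subtractf[symmetric] by (intro sum.cong) (auto simp: \<beta>_def)
  also have "(\<Sum>j<m. if j < 2 then 1 / T else 0) = (\<Sum>j<2::nat. 1 / T)"
    using m by (intro sum.mono_neutral_cong_right) auto
  finally have sum_\<beta>: "(\<Sum>j<m. \<beta> j) = real m - 2 / T"
    by simp
  have "graph_spectral_radius (core_gr k (complete_gr k) (complete_minus_edge_gr m)) > T - 1"
  proof (rule graph_spectral_radius_core_gr_gt[where m = m and \<alpha> = "\<lambda>_. 1 + \<delta>" and \<beta> = \<beta> and d = d])
    show "(T - 1) * (1 + \<delta>) < (\<Sum>j<k. if (i, j) \<in> parcs (complete_gr k) then 1 + \<delta> else 0)
        + (\<Sum>j<m. \<beta> j) + (real k + 1) * d" if "i < k" for i
      using d1 unfolding sum_\<beta> sum_neighbours_complete_gr[OF that]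
      by (simp add: T_def algebra_simps)
    show "(T - 1) * \<beta> i < (\<Sum>j<k. 1 + \<delta>)
        + (\<Sum>j<m. if (i, j) \<in> parcs (complete_minus_edge_gr m) then \<beta> j else 0)" if "i < m" for i
    proof (cases "i < 2")
      case True
      have "(T - 1) * \<beta> i = T - 2 + 1 / T"
        using True pos by (simp add: \<beta>_def field_simps)
      moreover have "1 / T < 2 / T"
        using pos by (simp add: divide_strict_right_mono)
      ultimately show ?thesis
        using True k\<delta> unfolding sum_neighbours_complete_minus_edge_gr[OF that m] sum_\<beta>
        by (simp add: \<beta>_def T_def algebra_simps)
    next
      case False
      then show ?thesis
        using k\<delta> unfolding sum_neighbours_complete_minus_edge_gr[OF that m] sum_\<beta>
        by (simp add: \<beta>_def T_def algebra_simps)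
    qed
    show "(T - 1) * d < (\<Sum>j<k. 1 + \<delta>)"
      using d2 by simp
    show "\<beta> i > 0" for i
      using k m by (simp add: \<beta>_def T_def)
  qed (use \<open>d > 0\<close> \<open>\<delta> > 0\<close> k m in
      \<open>auto simp: complete_minus_edge_gr_def complete_gr_def T_def\<close>)
  then show ?thesis by (simp add: T_def)
qed

theorem proposition9:
  fixes k n :: nat
  assumes "k \<ge> 2"
    and "2 * k + 1 \<le> n"
    and "real n \<le> real k ^ 3 / 2 + real k ^ 2 / 2 + real k + 2"
  shows "\<exists>G. pair_graph G \<and> card (pverts G) = n \<and> min_degree G \<ge> k
           \<and> proper_subgraph G (N_gr k n)
           \<and> graph_spectral_radius G > real n - real k - 2"
proof -
  define m where "m = n - 2 * k - 1"
  have n: "n = 2 * k + 1 + m"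
    using assms by (simp add: m_def)
  have t: "real n - real k - 2 = real k + real m - 1"
    by (simp add: n)
  \<comment> \<open>For \<open>m \<le> 1\<close> the clique has no edge, so the edge
    \<open>{0, 1}\<close> of the core is deleted instead.\<close>
  define H where "H = (if m \<le> 1 then complete_minus_edge_gr k else complete_gr k)"
  define K where "K = (if m \<le> 1 then complete_gr m else complete_minus_edge_gr m)"
  have pair_graphs: "pair_graph H" "pair_graph K"
    by (simp_all add: H_def K_def pair_graph_complete_gr pair_graph_complete_minus_edge_gr)
  have verts: "pverts H = {..<k}" "pverts K = {..<m}"
    by (simp_all add: H_def K_def complete_gr_def complete_minus_edge_gr_def)
  have "graph_spectral_radius (core_gr k H K) > real k + real m - 1"
  proof (cases "m \<le> 1")
    case True
    then show ?thesis
      using core_minus_edge_spectral_radius_gt[OF assms(1)] by (simp add: H_def K_def)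
  next
    case False
    \<comment> \<open>This is twice the upper bound on \<open>n\<close>, rewritten with
      \<open>n = 2 * k + 1 + m\<close>.\<close>
    have "2 * (real k + real m - 1) \<le> real k ^ 2 * (real k + 1)"
      using assms(3) by (simp add: n algebra_simps power3_eq_cube power2_eq_square)
    with False show ?thesis
      using clique_minus_edge_spectral_radius_gt[OF assms(1)] by (simp add: H_def K_def)
  qed
  moreover have "proper_subgraph (core_gr k H K) (N_gr k n)"
    unfolding N_gr_eq_core_gr m_def[symmetric]
  proof (rule proper_subgraph_core_gr)
    show "parcs H \<noteq> parcs (complete_gr k) \<or> parcs K \<noteq> parcs (complete_gr m)"
      using complete_minus_edge_gr_neq[of k] complete_minus_edge_gr_neq[of m] assms(1)
      by (auto simp: H_def K_def)
    show "parcs H \<subseteq> parcs (complete_gr k)" "parcs K \<subseteq> parcs (complete_gr m)"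
      using complete_minus_edge_gr_subset by (auto simp: H_def K_def)
    show "pverts H = pverts (complete_gr k)" "pverts K = pverts (complete_gr m)"
      by (simp_all add: verts complete_gr_def)
  qed (use pair_graphs in \<open>simp_all add: pair_graph_complete_gr\<close>)
  moreover have "min_degree (core_gr k H K) \<ge> k"
    using pair_graphs verts by (intro min_degree_core_gr) auto
  moreover have "card (pverts (core_gr k H K)) = n"
    by (simp add: pverts_core_gr verts card_Plus n)
  ultimately show ?thesis
    using pair_graph_core_gr[OF pair_graphs] t by auto
qed

end
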